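(* Let $C_p$ be a polynomial coherence measure on $\mathcal{H}_d=\mathbb{C}^d$ satisfying the criteria $(C1)$, $(C2)$ and $(C3)$ listed in the context. Then for any pure state $|\psi\rangle\in\mathcal{H}_d$ with $\operatorname{rank}(\Delta(|\psi\rangle\langle\psi|))<d$, one has $C_p(|\psi\rangle)=0$.
   Context: Fix the reference orthonormal basis $\{|i\rangle\}_{i=1,\dots,d}$ of $\mathcal{H}_d=\mathbb{C}^d$. A density matrix is incoherent if it is diagonal in this basis; $\mathcal{I}$ denotes the set of incoherent states. The dephasing channel is $\Delta(\rho)=\sum_{i=1}^d|i\rangle\langle i|\rho|i\rangle\langle i|$. An incoherent operation is a completely positive trace preserving map $\Phi(\rho)=\sum_n K_n\rho K_n^\dagger$ on $\mathcal{H}_d$ (with $\sum_n K_n^\dagger K_n=\mathbb{I}$), given with Kraus operators $K_n$ such that for every $\rho\in\mathcal{I}$ and every $n$ with $\mathrm{Tr}(K_n\rho K_n^\dagger)>0$, $K_n\rho K_n^\dagger/\mathrm{Tr}(K_n\rho K_n^\dagger)\in\mathcal{I}$. Polynomial coherence measure: let $P_h$ be a homogeneous polynomial of degree $h\ge 1$ with complex coefficients in the coefficients of a vector $|\psi\rangle=\sum_{i=1}^d a_i|i\rangle$, i.e. $P_h(|\psi\rangle)=\sum_{k_1+\cdots+k_d=h}\chi_{k_1\cdots k_d}\prod_{i=1}^d a_i^{k_i}$ with nonnegative integers $k_i$, and let $m>0$ be real. The corresponding measure on pure states (unit vectors) is $C_p(|\psi\rangle)=|P_h(|\psi\rangle)|^m$.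 It is extended to density matrices by the convex roof $C_p(\rho)=\min_{\{p_i,|\psi_i\rangle\}}\sum_i p_i C_p(|\psi_i\rangle)$, the minimum running over all (finite) pure-state decompositions $\rho=\sum_i p_i|\psi_i\rangle\langle\psi_i|$ with $p_i\ge 0$, $\sum_i p_i=1$; in particular $C_p(|\psi\rangle\langle\psi|)=C_p(|\psi\rangle)$. Criteria for a function $C$ from density matrices on $\mathcal{H}_d$ to $[0,\infty)$: $(C1)$ $C(\delta)=0$ if $\delta\in\mathcal{I}$. $(C2)$ For any incoherent operation $\Phi(\rho)=\sum_n K_n\rho K_n^\dagger$ and any state $\rho$, $C(\rho)\ge\sum_n p_n C(\rho_n)$, where $p_n=\mathrm{Tr}(K_n\rho K_n^\dagger)$, $\rho_n=K_n\rho K_n^\dagger/p_n$ (terms with $p_n=0$ omitted). $(C3)$ Convexity: $\sum_e p_e C(\rho_e)\ge C(\sum_e p_e\rho_e)$ for all states $\rho_e$ and probabilities $p_e$. *)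

theory Defs
  imports "HOL-Analysis.Analysis"
begin

text \<open>
  The Hilbert space of dimension \<open>d\<close> is \<open>complex^'d\<close> with \<open>d = CARD('d)\<close>; the reference basis
  vector labelled by \<open>i\<close> is \<open>axis i 1\<close>, and operators are matrices in this basis. The norm of
  \<open>complex^'d\<close> is the usual Hilbert space norm, but its library inner product is real-valued, so
  the sesquilinear notions are defined here.
\<close>

definition dagger :: "complex^'n^'m \<Rightarrow> complex^'m^'n" where
  "dagger A = map_matrix cnj (transpose A)"

definition ketbra :: "complex^'m \<Rightarrow> complex^'n \<Rightarrow> complex^'n^'m" where
  "ketbra \<psi> \<phi> = (\<chi> i j. \<psi> $ i * cnj (\<phi> $ j))"

definition pos_semidef :: "complex^'d^'d \<Rightarrow> bool" where
  "pos_semidef A \<longleftrightarrow>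
     dagger A = A \<and> (\<forall>x. 0 \<le> Re (\<Sum>i\<in>UNIV. cnj (x $ i) * (A *v x) $ i))"

definition density :: "complex^'d^'d \<Rightarrow> bool" where
  "density \<rho> \<longleftrightarrow> pos_semidef \<rho> \<and> trace \<rho> = 1"

definition incoherent_states :: "(complex^'d^'d) set" where
  "incoherent_states = {\<rho>. density \<rho> \<and> (\<forall>i j. i \<noteq> j \<longrightarrow> \<rho> $ i $ j = 0)}"

definition dephasing :: "complex^'d^'d \<Rightarrow> complex^'d^'d" where
  "dephasing \<rho> =
     (\<Sum>i\<in>UNIV. ketbra (axis i 1) (axis i 1) ** \<rho> ** ketbra (axis i 1) (axis i 1))"

text \<open>
  The trace below is a nonnegative real number whenever \<open>\<rho>\<close> is a density matrix, so taking the real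
  part only changes the type.
\<close>

definition outcome_prob :: "complex^'d^'d \<Rightarrow> complex^'d^'d \<Rightarrow> real" where
  "outcome_prob K \<rho> = Re (trace (K ** \<rho> ** dagger K))"

definition outcome_state :: "complex^'d^'d \<Rightarrow> complex^'d^'d \<Rightarrow> complex^'d^'d" where
  "outcome_state K \<rho> = (K ** \<rho> ** dagger K) /\<^sub>R outcome_prob K \<rho>"

text \<open>
  An incoherent operation is given by its Kraus operators \<open>K 0, \<dots>, K (N - 1)\<close>; complete
  positivity is automatic for maps presented in this form.
\<close>

definition incoherent_operation :: "nat \<Rightarrow> (nat \<Rightarrow> complex^'d^'d) \<Rightarrow> bool" where
  "incoherent_operation N K \<longleftrightarrow>
     (\<Sum>n<N. dagger (K n) ** K n) = mat 1 \<and>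
     (\<forall>\<rho>\<in>incoherent_states. \<forall>n<N.
        outcome_prob (K n) \<rho> > 0 \<longrightarrow> outcome_state (K n) \<rho> \<in> incoherent_states)"

definition crit_C1 :: "(complex^'d^'d \<Rightarrow> real) \<Rightarrow> bool" where
  "crit_C1 C \<longleftrightarrow> (\<forall>\<delta>\<in>incoherent_states. C \<delta> = 0)"

definition crit_C2 :: "(complex^'d^'d \<Rightarrow> real) \<Rightarrow> bool" where
  "crit_C2 C \<longleftrightarrow>
     (\<forall>N K \<rho>. incoherent_operation N K \<and> density \<rho> \<longrightarrow>
        C \<rho> \<ge> (\<Sum>n\<in>{n. n < N \<and> outcome_prob (K n) \<rho> > 0}.
                 outcome_prob (K n) \<rho> * C (outcome_state (K n) \<rho>)))"

definition crit_C3 :: "(complex^'d^'d \<Rightarrow> real) \<Rightarrow> bool" where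
  "crit_C3 C \<longleftrightarrow>
     (\<forall>N p \<rho>. (\<forall>e<N. p e \<ge> 0 \<and> density (\<rho> e)) \<and> (\<Sum>e<(N::nat). p e) = 1 \<longrightarrow>
        (\<Sum>e<N. p e * C (\<rho> e)) \<ge> C (\<Sum>e<N. p e *\<^sub>R \<rho> e))"

text \<open>
  A homogeneous polynomial of degree \<open>h\<close> is given by its coefficients \<open>c k\<close>, indexed by exponent
  vectors \<open>k\<close>; only the finitely many \<open>k\<close> of total degree \<open>h\<close> matter.
\<close>

definition hom_poly :: "nat \<Rightarrow> (('d::finite \<Rightarrow> nat) \<Rightarrow> complex) \<Rightarrow> complex^'d \<Rightarrow> complex" where
  "hom_poly h c \<psi> =
     (\<Sum>k\<in>{k. (\<Sum>i\<in>UNIV. k i) = h}. c k * (\<Prod>i\<in>UNIV. (\<psi> $ i) ^ k i))"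

lemma finite_exponents: "finite {k :: 'd::finite \<Rightarrow> nat. (\<Sum>i\<in>UNIV. k i) = h}"
proof (rule finite_subset)
  show "{k :: 'd \<Rightarrow> nat. (\<Sum>i\<in>UNIV. k i) = h} \<subseteq> PiE UNIV (\<lambda>_. {..h})"
    by (auto intro: member_le_sum)
  show "finite (PiE (UNIV :: 'd set) (\<lambda>_. {..h}))"
    by (intro finite_PiE) auto
qed

definition poly_coherence_pure ::
    "nat \<Rightarrow> (('d::finite \<Rightarrow> nat) \<Rightarrow> complex) \<Rightarrow> real \<Rightarrow> complex^'d \<Rightarrow> real" where
  "poly_coherence_pure h c m \<psi> = cmod (hom_poly h c \<psi>) powr m"

definition pure_decomposition ::
    "complex^'d^'d \<Rightarrow> nat \<Rightarrow> (nat \<Rightarrow> real) \<Rightarrow> (nat \<Rightarrow> complex^'d) \<Rightarrow> bool" where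
  "pure_decomposition \<rho> N p \<psi> \<longleftrightarrow>
     (\<forall>i<N. p i \<ge> 0 \<and> norm (\<psi> i) = 1) \<and> (\<Sum>i<N. p i) = 1 \<and>
     \<rho> = (\<Sum>i<N. p i *\<^sub>R ketbra (\<psi> i) (\<psi> i))"

text \<open>
  On density matrices the infimum in the convex roof of a continuous function is a minimum, by
  Caratheodory's theorem and compactness of the set of pure states.
\<close>

definition convex_roof :: "(complex^'d \<Rightarrow> real) \<Rightarrow> complex^'d^'d \<Rightarrow> real" where
  "convex_roof f \<rho> = Inf {(\<Sum>i<N. p i * f (\<psi> i)) | N p \<psi>. pure_decomposition \<rho> N p \<psi>}"

definition poly_coherence ::
    "nat \<Rightarrow> (('d::finite \<Rightarrow> nat) \<Rightarrow> complex) \<Rightarrow> real \<Rightarrow> complex^'d^'d \<Rightarrow> real" where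
  "poly_coherence h c m = convex_roof (poly_coherence_pure h c m)"

end

theory Submission
  imports Defs "HOL-Computational_Algebra.Fundamental_Theorem_Algebra"
begin

text \<open>
  Let \<open>P\<close> be the polynomial. Projecting out a coordinate and swapping two coordinates are incoherent,
  so by (C2) the zero set of \<open>P\<close> is closed under coordinate projections, and \<open>\<bar>P\<bar>\<close> does not increase
  under swaps. Suppose \<open>P v \<noteq> 0\<close> and \<open>v\<^sub>k = 0\<close>. Then \<open>w \<mapsto> P (v + w e\<^sub>k)\<close> has no root and is constant by
  the fundamental theorem of algebra. Combined with the swap of \<open>j\<close> and \<open>k\<close>, this allows any further
  coordinate \<open>j\<close> of \<open>v\<close> to be set to zero without making \<open>P\<close> vanish, which ends in the contradiction
  \<open>P 0 \<noteq> 0\<close>.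
\<close>

section \<open>Pure states\<close>

lemma norm_vec_squared: "(norm v)\<^sup>2 = (\<Sum>i\<in>UNIV. (cmod (v $ i))\<^sup>2)" for v :: "complex^'d::finite"
  by (simp add: norm_vec_def L2_set_def sum_nonneg)

lemma complex_norm_vec_squared:
  "complex_of_real ((norm v)\<^sup>2) = (\<Sum>i\<in>UNIV. v $ i * cnj (v $ i))" for v :: "complex^'d::finite"
  by (simp only: norm_vec_squared of_real_sum complex_norm_square)

lemma norm_vector_smult: "norm (z *s v) = cmod z * norm v" for v :: "complex^'d::finite"
proof -
  have "(norm (z *s v))\<^sup>2 = (cmod z * norm v)\<^sup>2"
    by (simp add: norm_vec_squared norm_mult power_mult_distrib sum_distrib_left)
  then show ?thesis
    by (simp add: power2_eq_iff_nonneg)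
qed

text \<open>Pythagoras: \<open>z\<close> is the overlap of \<phi> with the unit vector \<psi>, and
  subtracting \<open>z *s \<psi>\<close> leaves the orthogonal part. At \<open>cmod z = 1\<close>
  with \<phi> a unit vector, this is the equality case of Cauchy-Schwarz.\<close>

lemma norm_diff_projection:
  fixes \<psi> \<phi> :: "complex^'d::finite"
  assumes "norm \<psi> = 1"
  defines "z \<equiv> \<Sum>i\<in>UNIV. cnj (\<psi> $ i) * \<phi> $ i"
  shows "(norm (\<phi> - z *s \<psi>))\<^sup>2 = (norm \<phi>)\<^sup>2 - (cmod z)\<^sup>2"
proof -
  have 1: "(\<Sum>i\<in>UNIV. \<psi> $ i * cnj (\<psi> $ i)) = 1"
    using complex_norm_vec_squared[of \<psi>] assms(1) by simp
  have 2: "cnj z = (\<Sum>i\<in>UNIV. \<psi> $ i * cnj (\<phi> $ i))"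
    by (simp add: z_def)
  have "complex_of_real ((norm (\<phi> - z *s \<psi>))\<^sup>2) =
      (\<Sum>i\<in>UNIV. \<phi> $ i * cnj (\<phi> $ i) - cnj z * (cnj (\<psi> $ i) * \<phi> $ i)
        - z * (\<psi> $ i * cnj (\<phi> $ i)) + z * cnj z * (\<psi> $ i * cnj (\<psi> $ i)))"
    unfolding complex_norm_vec_squared by (intro sum.cong) (auto simp: algebra_simps)
  also have "\<dots> = complex_of_real ((norm \<phi>)\<^sup>2) - cnj z * z - z * cnj z + z * cnj z * 1"
    by (simp only: sum.distrib sum_subtractf sum_distrib_left[symmetric] 1
        z_def[symmetric] 2[symmetric] complex_norm_vec_squared)
  also have "\<dots> = complex_of_real ((norm \<phi>)\<^sup>2 - (cmod z)\<^sup>2)"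
    by (simp add: complex_norm_square mult.commute del: of_real_power)
  finally show ?thesis
    by (simp only: of_real_eq_iff)
qed

lemma ketbra_nth [simp]: "ketbra v w $ i $ j = v $ i * cnj (w $ j)"
  by (simp add: ketbra_def)

lemma trace_ketbra: "trace (ketbra v v) = complex_of_real ((norm v)\<^sup>2)"
  for v :: "complex^'d::finite"
  by (simp only: complex_norm_vec_squared trace_def ketbra_nth)

lemma dagger_nth [simp]: "dagger A $ i $ j = cnj (A $ j $ i)"
  by (simp add: dagger_def map_matrix_def transpose_def)

lemma dagger_mult_nth: "(dagger A ** A) $ i $ j = (\<Sum>k\<in>UNIV. cnj (A $ k $ i) * A $ k $ j)"
  by (simp add: matrix_matrix_mult_def)

lemma conjugate_ketbra: "K ** ketbra v v ** dagger K = ketbra (K *v v) (K *v v)"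
  for K :: "complex^'d::finite^'d"
  by (simp add: vec_eq_iff matrix_matrix_mult_def matrix_vector_mult_def sum_product
      sum_distrib_left sum_distrib_right mult_ac)

lemma density_ketbra:
  fixes v :: "complex^'d::finite"
  assumes "norm v = 1"
  shows "density (ketbra v v)"
  unfolding density_def pos_semidef_def
proof (intro conjI allI)
  show "dagger (ketbra v v) = ketbra v v"
    by (simp add: vec_eq_iff)
  show "trace (ketbra v v) = 1"
    by (simp add: trace_ketbra assms)
  fix x :: "complex^'d"
  \<comment> \<open>The quadratic form of a rank-one projector at \<open>x\<close> is the squared
    modulus of the overlap \<open>?z\<close>.\<close>
  let ?z = "\<Sum>i\<in>UNIV. cnj (x $ i) * v $ i"
  have "(\<Sum>i\<in>UNIV. cnj (x $ i) * (ketbra v v *v x) $ i) = ?z * cnj ?z"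
    by (simp add: matrix_vector_mult_def sum_product sum_distrib_left mult_ac) (rule sum.swap)
  then show "0 \<le> Re (\<Sum>i\<in>UNIV. cnj (x $ i) * (ketbra v v *v x) $ i)"
    by (simp only: complex_norm_square[symmetric]) simp
qed

text \<open>Sandwiching the decomposition between \<open>\<psi>\<close> and itself shows that all overlaps with \<open>\<psi>\<close>
  have modulus one.\<close>

lemma pure_decomposition_ketbra:
  fixes \<psi> :: "complex^'d::finite"
  assumes "norm \<psi> = 1" and dec: "pure_decomposition (ketbra \<psi> \<psi>) N p \<phi>"
    and "i < N" and "p i \<noteq> 0"
  obtains z where "cmod z = 1" "\<phi> i = z *s \<psi>"
proof -
  define z where "z = (\<lambda>e. \<Sum>a\<in>UNIV. cnj (\<psi> $ a) * \<phi> e $ a)"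
  from dec have p: "\<And>e. e < N \<Longrightarrow> 0 \<le> p e" and n: "\<And>e. e < N \<Longrightarrow> norm (\<phi> e) = 1"
    and s: "(\<Sum>e<N. p e) = 1"
    and eq: "ketbra \<psi> \<psi> = (\<Sum>e<N. p e *\<^sub>R ketbra (\<phi> e) (\<phi> e))"
    by (auto simp: pure_decomposition_def)
  \<comment> \<open>\<open>S A\<close> is the sandwich <\<psi>|A|\<psi>>, linear in
    \<open>A\<close>; on \<open>ketbra v v\<close> it is the squared overlap of \<open>v\<close>
    with \<psi>.\<close>
  define S where "S = (\<lambda>A::complex^'d^'d. \<Sum>a\<in>UNIV. \<Sum>b\<in>UNIV. cnj (\<psi> $ a) * A $ a $ b * \<psi> $ b)"
  have S_ketbra: "S (ketbra v v) = complex_of_real ((cmod (\<Sum>a\<in>UNIV. cnj (\<psi> $ a) * v $ a))\<^sup>2)" for v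
    unfolding complex_norm_square S_def
    by (simp add: sum_product mult_ac) (rule sum.swap)
  have S_add: "S (A + B) = S A + S B" for A B
    by (simp add: S_def algebra_simps sum.distrib)
  have S_scale: "S (r *\<^sub>R A) = complex_of_real r * S A" for r A
    by (simp add: S_def scaleR_conv_of_real[where 'a = complex] sum_distrib_left mult_ac)
  have S_0: "S 0 = 0"
    by (simp add: S_def)
  have S_sum: "S (\<Sum>e<M. p e *\<^sub>R ketbra (\<phi> e) (\<phi> e)) = (\<Sum>e<M. p e * (cmod (z e))\<^sup>2)" for M
    by (induction M) (simp_all add: S_0 S_add S_scale S_ketbra z_def)
  have "(\<Sum>a\<in>UNIV. cnj (\<psi> $ a) * \<psi> $ a) = 1"
    using complex_norm_vec_squared[of \<psi>] assms(1) by (simp add: mult.commute)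
  then have "S (ketbra \<psi> \<psi>) = 1"
    by (simp add: S_ketbra)
  then have overlap: "(\<Sum>e<N. p e * (cmod (z e))\<^sup>2) = 1"
    using S_sum[of N] eq by (metis of_real_eq_1_iff)
  have proj: "(norm (\<phi> e - z e *s \<psi>))\<^sup>2 = 1 - (cmod (z e))\<^sup>2" if "e < N" for e
    using norm_diff_projection[OF assms(1), of "\<phi> e"] n[OF that] by (simp add: z_def)
  have le: "0 \<le> 1 - (cmod (z e))\<^sup>2" if "e < N" for e
    using proj[OF that] by (metis zero_le_power2)
  \<comment> \<open>The deficits of the squared overlaps from 1 are nonnegative with weighted mean
    0, so a deficit with nonzero weight vanishes.\<close>
  have "(\<Sum>e<N. p e * (1 - (cmod (z e))\<^sup>2)) = 0"
    using overlap s by (simp add: algebra_simps sum_subtractf)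
  then have "p i * (1 - (cmod (z i))\<^sup>2) = 0"
    using sum_nonneg_eq_0_iff[of "{..<N}" "\<lambda>e. p e * (1 - (cmod (z e))\<^sup>2)"] p le assms(3) by simp
  then have one: "(cmod (z i))\<^sup>2 = 1"
    using assms(4) by simp
  show thesis
  proof (rule that)
    show "cmod (z i) = 1"
      using one by (simp add: power2_eq_1_iff) (metis norm_ge_zero neg_0_le_iff_le not_one_le_zero)
    show "\<phi> i = z i *s \<psi>"
      using proj[OF assms(3)] one by simp
  qed
qed

text \<open>Every decomposition of a pure state consists of phase multiples of \<psi>, up to terms
  of weight zero, so the infimum runs over the single value \<open>f \<psi>\<close>.\<close>

lemma convex_roof_ketbra:
  fixes f :: "complex^'d::finite \<Rightarrow> real"
  assumes nonneg: "\<And>v. 0 \<le> f v"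
    and phase: "\<And>z v. cmod z = 1 \<Longrightarrow> f (z *s v) = f v"
    and "norm \<psi> = 1"
  shows "convex_roof f (ketbra \<psi> \<psi>) = f \<psi>"
proof -
  let ?A = "{(\<Sum>i<N. p i * f (\<phi> i)) | N p \<phi>. pure_decomposition (ketbra \<psi> \<psi>) N p \<phi>}"
  have triv: "pure_decomposition (ketbra \<psi> \<psi>) 1 (\<lambda>_. 1) (\<lambda>_. \<psi>)"
    by (simp add: pure_decomposition_def assms(3))
  have "(\<Sum>i<N. p i * f (\<phi> i)) = f \<psi>" if dec: "pure_decomposition (ketbra \<psi> \<psi>) N p \<phi>" for N p \<phi>
  proof -
    have "p i * f (\<phi> i) = p i * f \<psi>" if "i < N" for i
      using pure_decomposition_ketbra[OF assms(3) dec that] phase by (metis mult_zero_left)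
    then have "(\<Sum>i<N. p i * f (\<phi> i)) = (\<Sum>i<N. p i) * f \<psi>"
      unfolding sum_distrib_right by (intro sum.cong) auto
    then show ?thesis
      using dec by (simp add: pure_decomposition_def)
  qed
  then have "?A \<subseteq> {f \<psi>}" by blast
  moreover have "f \<psi> \<in> ?A"
    using triv by force
  ultimately have "?A = {f \<psi>}" by blast
  then show ?thesis
    by (simp add: convex_roof_def)
qed

section \<open>Incoherent Kraus operators\<close>

lemma pos_semidef_conjugate:
  fixes K :: "complex^'d::finite^'d"
  assumes "pos_semidef \<rho>"
  shows "pos_semidef (K ** \<rho> ** dagger K)"
  unfolding pos_semidef_def
proof (intro conjI allI)
  have herm: "cnj (\<rho> $ i $ j) = \<rho> $ j $ i" for i j
    using assms by (simp add: pos_semidef_def vec_eq_iff)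
  show "dagger (K ** \<rho> ** dagger K) = K ** \<rho> ** dagger K"
    by (simp add: vec_eq_iff matrix_matrix_mult_def herm sum_distrib_left sum_distrib_right mult_ac)
      (subst sum.swap, simp)
  fix x :: "complex^'d"
  \<comment> \<open>Moving \<open>K\<close> to the other side turns the form at \<open>x\<close>
    into the form of \<rho> at \<open>dagger K *v x\<close>.\<close>
  have "(\<Sum>i\<in>UNIV. cnj (x $ i) * (K *v w) $ i) =
      (\<Sum>j\<in>UNIV. cnj ((dagger K *v x) $ j) * w $ j)" for w
    by (simp add: matrix_vector_mult_def sum_distrib_left sum_distrib_right mult_ac)
      (subst sum.swap, simp)
  then show "0 \<le> Re (\<Sum>i\<in>UNIV. cnj (x $ i) * ((K ** \<rho> ** dagger K) *v x) $ i)"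
    using assms by (simp add: matrix_vector_mul_assoc[symmetric] pos_semidef_def)
qed

lemma density_outcome_state:
  fixes K :: "complex^'d::finite^'d"
  assumes "density \<rho>" and "outcome_prob K \<rho> > 0"
  shows "density (outcome_state K \<rho>)"
proof -
  let ?A = "K ** \<rho> ** dagger K"
  have psd: "pos_semidef ?A"
    using assms(1) by (simp add: density_def pos_semidef_conjugate)
  \<comment> \<open>A Hermitian matrix has real trace, so the real part in
    \<open>outcome_prob\<close> loses nothing and the normalized trace is exactly 1.\<close>
  then have "cnj (?A $ i $ i) = ?A $ i $ i" for i
    by (metis dagger_nth pos_semidef_def)
  then have "cnj (trace ?A) = trace ?A"
    by (simp add: trace_def)
  then have tr: "trace ?A = complex_of_real (outcome_prob K \<rho>)"
    by (metis complex_cnj_cancel_iff outcome_prob_def Reals_cnj_iff complex_is_Real_iff of_real_Re)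
  have "trace (outcome_state K \<rho>) = trace ?A /\<^sub>R outcome_prob K \<rho>"
    by (simp add: outcome_state_def trace_def scaleR_sum_right)
  then have "trace (outcome_state K \<rho>) = 1"
    using tr assms(2) by (simp add: scaleR_conv_of_real[where 'a = complex])
  moreover have "pos_semidef (outcome_state K \<rho>)"
    unfolding pos_semidef_def
  proof (intro conjI allI)
    show "dagger (outcome_state K \<rho>) = outcome_state K \<rho>"
      using psd by (simp add: pos_semidef_def outcome_state_def vec_eq_iff scaleR_conv_of_real[where 'a = complex])
    fix x :: "complex^'d"
    have "(\<Sum>i\<in>UNIV. cnj (x $ i) * (outcome_state K \<rho> *v x) $ i) =
        (\<Sum>i\<in>UNIV. cnj (x $ i) * (?A *v x) $ i) /\<^sub>R outcome_prob K \<rho>"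
      by (simp add: outcome_state_def matrix_vector_mult_def scaleR_sum_right sum_distrib_left
          scaleR_conv_of_real[where 'a = complex] mult_ac)
    then show "0 \<le> Re (\<Sum>i\<in>UNIV. cnj (x $ i) * (outcome_state K \<rho> *v x) $ i)"
      using psd assms(2) by (simp add: pos_semidef_def)
  qed
  ultimately show ?thesis
    by (simp add: density_def)
qed

text \<open>If each column has at most one nonzero entry, basis vectors go to multiples of basis
  vectors, and diagonal matrices stay diagonal.\<close>

lemma incoherent_operationI:
  fixes K :: "nat \<Rightarrow> complex^'d::finite^'d"
  assumes "(\<Sum>n<N. dagger (K n) ** K n) = mat 1"
    and column: "\<And>n i l j. n < N \<Longrightarrow> i \<noteq> l \<Longrightarrow> K n $ i $ j = 0 \<or> K n $ l $ j = 0"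
  shows "incoherent_operation N K"
  unfolding incoherent_operation_def
proof (intro conjI ballI allI impI)
  fix \<rho> :: "complex^'d^'d" and n
  assume \<rho>: "\<rho> \<in> incoherent_states" and n: "n < N" and pos: "0 < outcome_prob (K n) \<rho>"
  have off: "a \<noteq> b \<Longrightarrow> \<rho> $ a $ b = 0" for a b
    using \<rho> by (simp add: incoherent_states_def)
  have "(K n ** \<rho> ** dagger (K n)) $ i $ l = 0" if "i \<noteq> l" for i l
  proof -
    have "K n $ i $ a * \<rho> $ a $ b * cnj (K n $ l $ b) = 0" for a b
      using off[of a b] column[OF n that, of a] by (cases "a = b") auto
    moreover have "(K n ** \<rho> ** dagger (K n)) $ i $ l =
        (\<Sum>b\<in>UNIV. \<Sum>a\<in>UNIV. K n $ i $ a * \<rho> $ a $ b * cnj (K n $ l $ b))"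
      by (simp add: matrix_matrix_mult_def sum_distrib_right)
    ultimately show ?thesis
      by (simp only: sum.neutral_const)
  qed
  then show "outcome_state (K n) \<rho> \<in> incoherent_states"
    using \<rho> pos density_outcome_state[of \<rho> "K n"]
    by (simp add: incoherent_states_def outcome_state_def)
qed (fact assms(1))

section \<open>Coordinate projections and swaps as incoherent operations\<close>

definition coordinate_projection :: "'d set \<Rightarrow> complex^'d::finite^'d" where
  "coordinate_projection A = (\<chi> i j. if i = j \<and> i \<in> A then 1 else 0)"

lemma coordinate_projection_mult:
  "coordinate_projection A *v v = (\<chi> i. if i \<in> A then v $ i else 0)"
  by (simp add: coordinate_projection_def matrix_vector_mult_def vec_eq_iff if_distrib if_distribR
      cong: if_cong)

text \<open>The measurement that asks whether the basis label lies in \<open>A\<close>; the Kraus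
  operators in use are those at 0 and 1.\<close>

definition binary_projection :: "'d set \<Rightarrow> nat \<Rightarrow> complex^'d::finite^'d" where
  "binary_projection A n = coordinate_projection (if n = 0 then A else - A)"

lemma incoherent_binary_projection: "incoherent_operation 2 (binary_projection A)"
proof (rule incoherent_operationI)
  have diag: "(dagger (coordinate_projection B) ** coordinate_projection B) $ i $ j =
      (if i = j \<and> i \<in> B then 1 else 0)" for B and i j :: 'a
  proof -
    have "(dagger (coordinate_projection B) ** coordinate_projection B) $ i $ j =
       (\<Sum>k\<in>UNIV. if k = i then (if i = j \<and> i \<in> B then 1 else 0) else 0)"
      unfolding dagger_mult_nth by (intro sum.cong) (auto simp: coordinate_projection_def)
    then show ?thesis by simp
  qed
  show "(\<Sum>n<2. dagger (binary_projection A n) ** binary_projection A n) = mat 1"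
    by (simp add: vec_eq_iff numeral_2_eq_2 binary_projection_def diag mat_def)
qed (auto simp: binary_projection_def coordinate_projection_def)

definition swap_matrix :: "'d \<Rightarrow> 'd \<Rightarrow> complex^'d::finite^'d" where
  "swap_matrix a b = (\<chi> i j. if j = Transposition.transpose a b i then 1 else 0)"

lemma swap_matrix_mult: "(swap_matrix a b *v v) $ i = v $ Transposition.transpose a b i"
  by (simp add: swap_matrix_def matrix_vector_mult_def if_distrib if_distribR cong: if_cong)

lemma incoherent_swap: "incoherent_operation 1 (\<lambda>_. swap_matrix a b)"
proof (rule incoherent_operationI)
  have "(dagger (swap_matrix a b) ** swap_matrix a b) $ i $ j = (if i = j then 1 else 0)" for i j
  proof -
    have "(dagger (swap_matrix a b) ** swap_matrix a b) $ i $ j =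
       (\<Sum>k\<in>UNIV. if k = Transposition.transpose a b i then (if i = j then 1 else 0) else 0)"
      unfolding dagger_mult_nth by (intro sum.cong) (auto simp: swap_matrix_def)
    then show ?thesis by simp
  qed
  then have "dagger (swap_matrix a b) ** swap_matrix a b = mat 1"
    by (simp add: vec_eq_iff mat_def)
  then show "(\<Sum>n<1::nat. dagger (swap_matrix a b) ** swap_matrix a b) = mat 1"
    by (simp only: One_nat_def sum.lessThan_Suc lessThan_0 sum.empty add_0)
  show "swap_matrix a b $ i $ j = 0 \<or> swap_matrix a b $ l $ j = 0" if "i \<noteq> l" for i l j
    using that by (auto simp: swap_matrix_def inj_eq[OF inj_transpose])
qed

lemma norm_swap_matrix_mult: "norm (swap_matrix a b *v v) = norm v"
proof -
  have "(norm (swap_matrix a b *v v))\<^sup>2 = (norm v)\<^sup>2"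
    unfolding norm_vec_squared swap_matrix_mult
    by (rule sum.reindex_bij_betw[of "Transposition.transpose a b"]) simp
  then show ?thesis
    by (simp add: power2_eq_iff_nonneg)
qed

section \<open>Homogeneous polynomials\<close>

lemma hom_poly_smult: "hom_poly h c (z *s v) = z ^ h * hom_poly h c v"
proof -
  have "c k * (\<Prod>i\<in>UNIV. ((z *s v) $ i) ^ k i) = z ^ h * (c k * (\<Prod>i\<in>UNIV. (v $ i) ^ k i))"
    if "(\<Sum>i\<in>UNIV. k i) = h" for k
    unfolding that[symmetric] by (simp add: power_mult_distrib prod.distrib power_sum)
  then show ?thesis
    unfolding hom_poly_def sum_distrib_left by (intro sum.cong) auto
qed

text \<open>Restriction to a complex line gives a univariate polynomial, to which root arguments
  apply.\<close>

lemma hom_poly_line: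
  obtains q where "\<And>w. hom_poly h c (v + w *s u) = poly q w"
proof
  show "hom_poly h c (v + w *s u) =
      poly (\<Sum>k\<in>{k. (\<Sum>i\<in>UNIV. k i) = h}. smult (c k) (\<Prod>i\<in>UNIV. [:v $ i, u $ i:] ^ k i)) w" for w
    by (simp add: hom_poly_def poly_sum poly_prod poly_power)
qed

section \<open>Consequences of (C2) for the polynomial\<close>

lemma poly_coherence_ketbra:
  assumes "norm \<psi> = 1"
  shows "poly_coherence h c m (ketbra \<psi> \<psi>) = poly_coherence_pure h c m \<psi>"
  unfolding poly_coherence_def
  by (rule convex_roof_ketbra)
    (simp_all add: poly_coherence_pure_def hom_poly_smult norm_mult norm_power assms)

text \<open>This is (C2) at a pure state with a single outcome kept: a Kraus operator sends a pure
  state to a pure state, with probability the squared norm of the image.\<close>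

lemma poly_coherence_monotone:
  fixes v :: "complex^'d::finite"
  assumes C2: "crit_C2 (poly_coherence h c m)" and K: "incoherent_operation N K"
    and "n < N" and "norm v = 1" and "K n *v v \<noteq> 0"
  shows "(norm (K n *v v))\<^sup>2 * poly_coherence_pure h c m ((1 / norm (K n *v v)) *s (K n *v v))
    \<le> poly_coherence_pure h c m v"
proof -
  have prob: "outcome_prob (K n) (ketbra v v) = (norm (K n *v v))\<^sup>2" for n
    by (simp add: outcome_prob_def conjugate_ketbra trace_ketbra)
  have state: "poly_coherence h c m (outcome_state (K n) (ketbra v v)) =
      poly_coherence_pure h c m ((1 / norm (K n *v v)) *s (K n *v v))" if "K n *v v \<noteq> 0" for n
  proof -
    let ?r = "norm (K n *v v)" let ?u = "(1 / ?r) *s (K n *v v)"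
    have "norm ?u = 1"
      using that by (simp add: norm_vector_smult norm_divide)
    moreover have "outcome_state (K n) (ketbra v v) = ketbra ?u ?u"
      by (simp add: outcome_state_def prob conjugate_ketbra vec_eq_iff scaleR_conv_of_real[where 'a = complex]
          power2_eq_square divide_inverse mult_ac)
    ultimately show ?thesis
      by (simp only: poly_coherence_ketbra)
  qed
  \<comment> \<open>The outcomes dropped from the sum contribute nonnegative terms, since their
    states are pure as well.\<close>
  have "(norm (K n *v v))\<^sup>2 * poly_coherence h c m (outcome_state (K n) (ketbra v v)) \<le>
     (\<Sum>n\<in>{n. n < N \<and> outcome_prob (K n) (ketbra v v) > 0}.
        outcome_prob (K n) (ketbra v v) * poly_coherence h c m (outcome_state (K n) (ketbra v v)))"
    unfolding prob
    by (rule member_le_sum) (use assms in \<open>auto simp: state poly_coherence_pure_def\<close>)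
  also have "\<dots> \<le> poly_coherence h c m (ketbra v v)"
    using C2 K density_ketbra[OF assms(4)] unfolding crit_C2_def by blast
  finally show ?thesis
    using state[OF assms(5)] by (simp add: poly_coherence_ketbra[OF assms(4)])
qed

lemma hom_poly_zero: "h \<ge> 1 \<Longrightarrow> hom_poly h c 0 = 0"
  using hom_poly_smult[of h c 0 0] by (simp add: power_0_left)

lemma hom_poly_normalized:
  assumes "v \<noteq> 0"
  shows "hom_poly h c v = complex_of_real (norm v) ^ h * hom_poly h c ((1 / norm v) *s v)"
  unfolding hom_poly_smult[symmetric] using assms by (simp add: vector_smult_assoc)

text \<open>Where the measure is zero, (C2) forces it to be zero at every outcome; homogeneity
  removes the normalizations.\<close>

lemma hom_poly_kraus_eq_0:
  fixes v :: "complex^'d::finite"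
  assumes "h \<ge> 1" and "m > 0" and C2: "crit_C2 (poly_coherence h c m)"
    and K: "incoherent_operation N K" and "n < N" and 0: "hom_poly h c v = 0"
  shows "hom_poly h c (K n *v v) = 0"
proof (cases "v = 0 \<or> K n *v v = 0")
  case True
  then show ?thesis
    using hom_poly_zero[OF assms(1)] by auto
next
  case False
  let ?u = "(1 / norm v) *s v"
  have u: "norm ?u = 1"
    using False by (simp add: norm_vector_smult norm_divide)
  have Ku: "K n *v ?u = (1 / norm v) *s (K n *v v)"
    by (simp add: vec_eq_iff matrix_vector_mult_def sum_distrib_left mult_ac)
  then have ne: "K n *v ?u \<noteq> 0"
    using False by simp
  have "poly_coherence_pure h c m ?u = 0"
    by (simp add: poly_coherence_pure_def hom_poly_smult 0)
  then have "poly_coherence_pure h c m ((1 / norm (K n *v ?u)) *s (K n *v ?u)) \<le> 0"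
    using poly_coherence_monotone[OF C2 K assms(5) u ne] ne
    by (simp add: mult_le_0_iff)
  then have "hom_poly h c ((1 / norm (K n *v ?u)) *s (K n *v ?u)) = 0"
    using powr_gt_zero by (simp add: poly_coherence_pure_def)
  then have "hom_poly h c (K n *v ?u) = 0"
    using hom_poly_normalized[OF ne] by simp
  then show ?thesis
    using False unfolding Ku by (simp add: hom_poly_smult)
qed

text \<open>A swap is unitary, so its only outcome has probability one and (C2) compares the two
  values directly. Strict monotonicity of \<open>powr\<close> for positive \<open>m\<close> strips
  the exponent.\<close>

lemma hom_poly_swap_le:
  fixes v :: "complex^'d::finite"
  assumes "h \<ge> 1" and "m > 0" and C2: "crit_C2 (poly_coherence h c m)"
  shows "cmod (hom_poly h c (swap_matrix a b *v v)) \<le> cmod (hom_poly h c v)"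
proof (cases "v = 0")
  case True
  then show ?thesis by simp
next
  case False
  let ?u = "(1 / norm v) *s v" and ?S = "swap_matrix a b"
  have u: "norm ?u = 1" "norm (?S *v ?u) = 1"
    using False by (simp_all add: norm_swap_matrix_mult norm_vector_smult norm_divide)
  then have "?S *v ?u \<noteq> 0"
    by (metis norm_zero zero_neq_one)
  then have "poly_coherence_pure h c m (?S *v ?u) \<le> poly_coherence_pure h c m ?u"
    using poly_coherence_monotone[OF C2 incoherent_swap _ u(1), of 0 a b] u(2) by simp
  then have "cmod (hom_poly h c (?S *v ?u)) \<le> cmod (hom_poly h c ?u)"
    using assms(2) unfolding poly_coherence_pure_def by (meson norm_ge_zero not_le powr_less_mono2)
  moreover have "?S *v ?u = (1 / norm v) *s (?S *v v)"
    by (simp add: vec_eq_iff swap_matrix_mult)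
  ultimately show ?thesis
    using False by (simp add: hom_poly_smult norm_mult norm_power norm_divide divide_le_cancel power_divide)
qed

section \<open>Vanishing on vectors with a zero coordinate\<close>

lemma hom_poly_constant_in_zero_coordinate:
  fixes v :: "complex^'d::finite"
  assumes "h \<ge> 1" and "m > 0" and C2: "crit_C2 (poly_coherence h c m)"
    and "v $ k = 0" and "hom_poly h c v \<noteq> 0"
  shows "hom_poly h c (v + w *s axis k 1) = hom_poly h c v"
proof -
  obtain q where q: "\<And>w. hom_poly h c (v + w *s axis k 1) = poly q w"
    using hom_poly_line[of h c v "axis k 1"] by blast
  have "poly q w \<noteq> 0" for w
  proof
    assume "poly q w = 0"
    then have "hom_poly h c (v + w *s axis k 1) = 0"
      by (simp add: q)
    \<comment> \<open>Projecting out coordinate \<open>k\<close> leads from any point of the line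
      back to \<open>v\<close>, so a root on the line would make the polynomial vanish at
      \<open>v\<close>.\<close>
    from hom_poly_kraus_eq_0[OF assms(1-3) incoherent_binary_projection[of "- {k}"] _ this, of 0]
    have "hom_poly h c (coordinate_projection (- {k}) *v (v + w *s axis k 1)) = 0"
      by (simp add: binary_projection_def)
    moreover have "coordinate_projection (- {k}) *v (v + w *s axis k 1) = v"
      using assms(4) by (auto simp: coordinate_projection_mult vec_eq_iff axis_def)
    ultimately show False
      using assms(5) by simp
  qed
  then have "constant (poly q)"
    using fundamental_theorem_of_algebra by blast
  then show ?thesis
    using q[of w] q[of 0] by (simp add: constant_def)
qed

text \<open>Constancy in the coordinate \<open>k\<close> persists when the coordinate \<open>j\<close> is set to zero: it holds at
  all values of the coordinate \<open>j\<close> where \<open>P\<close> does not vanish, hence as a polynomial identity in this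
  coordinate. Swapping \<open>j\<close> and \<open>k\<close> turns it into constancy in \<open>j\<close>.\<close>

lemma hom_poly_delete_coordinate:
  fixes v :: "complex^'d::finite"
  assumes h: "h \<ge> 1" "m > 0" "crit_C2 (poly_coherence h c m)"
    and "v $ k = 0" and "j \<noteq> k" and "hom_poly h c v \<noteq> 0"
  shows "hom_poly h c (v - (v $ j) *s axis j 1) \<noteq> 0"
proof
  define u where "u = v - (v $ j) *s axis j 1"
  assume "hom_poly h c (v - (v $ j) *s axis j 1) = 0"
  then have u0: "hom_poly h c u = 0"
    by (simp add: u_def)
  have u_k: "u $ k = 0" and u_j: "u $ j = 0" and v: "v = u + (v $ j) *s axis j 1"
    using assms(4,5) by (simp_all add: u_def axis_def)
  \<comment> \<open>Both \<open>q\<close> and \<open>r\<close> let coordinate \<open>j\<close> vary;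
    coordinate \<open>k\<close> is 0 for \<open>q\<close> and has the old value \<open>v $ j\<close>
    for \<open>r\<close>.\<close>
  obtain q where q: "\<And>w. hom_poly h c (u + w *s axis j 1) = poly q w"
    using hom_poly_line[of h c u "axis j 1"] by blast
  obtain r where r: "\<And>w. hom_poly h c ((u + (v $ j) *s axis k 1) + w *s axis j 1) = poly r w"
    using hom_poly_line[of h c "u + (v $ j) *s axis k 1" "axis j 1"] by blast
  have "poly q w * poly (r - q) w = 0" for w
  proof (cases "poly q w = 0")
    case False
    have "hom_poly h c ((u + w *s axis j 1) + (v $ j) *s axis k 1) = hom_poly h c (u + w *s axis j 1)"
    proof (rule hom_poly_constant_in_zero_coordinate[OF h])
      show "(u + w *s axis j 1) $ k = 0"
        using u_k assms(5) by (simp add: axis_def)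
      show "hom_poly h c (u + w *s axis j 1) \<noteq> 0"
        using False by (simp only: q not_False_eq_True)
    qed
    then show ?thesis
      using q[of w] r[of w] by (simp add: add_ac)
  qed simp
  then have "q * (r - q) = 0"
    by (simp flip: poly_all_0_iff_0)
  moreover have "q \<noteq> 0"
    using q[of "v $ j"] v assms(6) by auto
  ultimately have "r = q" by simp
  \<comment> \<open>Evaluation of \<open>r = q\<close> at 0 carries the assumed zero at
    \<open>u\<close> over to the vector with \<open>v $ j\<close> in position \<open>k\<close>. The
    swap takes this vector to \<open>v\<close>, where the polynomial would then vanish too.\<close>
  then have "hom_poly h c (u + (v $ j) *s axis k 1) = 0"
    using q[of 0] r[of 0] u0 by simp
  moreover have "swap_matrix j k *v (u + (v $ j) *s axis k 1) = v"
  proof -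
    have "(u + (v $ j) *s axis k 1) $ Transposition.transpose j k i = (u + (v $ j) *s axis j 1) $ i" for i
      using u_k u_j assms(5) by (cases "i = j"; cases "i = k") (auto simp: axis_def)
    then have "swap_matrix j k *v (u + (v $ j) *s axis k 1) = u + (v $ j) *s axis j 1"
      unfolding vec_eq_iff swap_matrix_mult by blast
    then show ?thesis
      using v[symmetric] by (rule trans)
  qed
  ultimately show False
    using hom_poly_swap_le[OF h, of j k "u + (v $ j) *s axis k 1"] assms(6) by simp
qed

text \<open>Induction on the size of the support: deleting a nonzero coordinate leaves coordinate
  \<open>k\<close> at zero, and a nonzero value would survive every deletion down to the zero
  vector.\<close>

lemma hom_poly_eq_0_if_zero_coordinate:
  fixes v :: "complex^'d::finite"
  assumes h: "h \<ge> 1" "m > 0" "crit_C2 (poly_coherence h c m)" and "v $ k = 0"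
  shows "hom_poly h c v = 0"
  using assms(4)
proof (induction "card {i. v $ i \<noteq> 0}" arbitrary: v rule: less_induct)
  case less
  show ?case
  proof (cases "v = 0")
    case True
    then show ?thesis
      using hom_poly_zero[OF h(1)] by simp
  next
    case False
    then obtain j where j: "v $ j \<noteq> 0"
      by (auto simp: vec_eq_iff)
    then have "j \<noteq> k"
      using less.prems by auto
    let ?u = "v - (v $ j) *s axis j 1"
    have "{i. ?u $ i \<noteq> 0} \<subset> {i. v $ i \<noteq> 0}"
      using j by (auto simp: axis_def)
    then have "card {i. ?u $ i \<noteq> 0} < card {i. v $ i \<noteq> 0}"
      by (simp add: psubset_card_mono)
    moreover have "?u $ k = 0"
      using less.prems \<open>j \<noteq> k\<close> by (simp add: axis_def)
    ultimately have "hom_poly h c ?u = 0"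
      by (rule less.hyps)
    then show ?thesis
      using hom_poly_delete_coordinate[OF h less.prems \<open>j \<noteq> k\<close>] by blast
  qed
qed

section \<open>The rank of a dephased pure state\<close>

lemma coordinate_projection_matrix_mult:
  "(coordinate_projection A ** \<rho>) $ i $ j = (if i \<in> A then \<rho> $ i $ j else 0)"
proof -
  have "(coordinate_projection A ** \<rho>) $ i $ j =
      (\<Sum>k\<in>UNIV. coordinate_projection A $ i $ k * \<rho> $ k $ j)"
    by (simp add: matrix_matrix_mult_def)
  also have "\<dots> = (\<Sum>k\<in>UNIV. if k = i then (if i \<in> A then \<rho> $ i $ j else 0) else 0)"
    by (intro sum.cong) (auto simp: coordinate_projection_def)
  finally show ?thesis by simp
qed

lemma matrix_mult_coordinate_projection:
  "(\<rho> ** coordinate_projection A) $ i $ j = (if j \<in> A then \<rho> $ i $ j else 0)"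
proof -
  have "(\<rho> ** coordinate_projection A) $ i $ j =
      (\<Sum>k\<in>UNIV. \<rho> $ i $ k * coordinate_projection A $ k $ j)"
    by (simp add: matrix_matrix_mult_def)
  also have "\<dots> = (\<Sum>k\<in>UNIV. if k = j then (if j \<in> A then \<rho> $ i $ j else 0) else 0)"
    by (intro sum.cong) (auto simp: coordinate_projection_def)
  finally show ?thesis by simp
qed

lemma dephasing_nth: "dephasing \<rho> $ i $ j = (if i = j then \<rho> $ i $ i else 0)"
proof -
  have "ketbra (axis k 1) (axis k 1) = (coordinate_projection {k} :: complex^'a^'a)" for k
    by (simp add: vec_eq_iff coordinate_projection_def axis_def)
  then have "dephasing \<rho> $ i $ j =
      (\<Sum>k\<in>UNIV. if k = i then (if i = j then \<rho> $ i $ i else 0) else 0)"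
    by (simp add: dephasing_def coordinate_projection_matrix_mult matrix_mult_coordinate_projection)
  then show ?thesis by simp
qed

text \<open>The dephased state is diagonal with entries |\<psi>_k|^2; if none is zero, its
  determinant is nonzero and the rank is full.\<close>

lemma rank_dephasing_ketbra_less:
  fixes \<psi> :: "complex^'d::finite"
  assumes "rank (dephasing (ketbra \<psi> \<psi>)) < CARD('d)"
  obtains k where "\<psi> $ k = 0"
proof (rule ccontr)
  let ?A = "dephasing (ketbra \<psi> \<psi>)"
  assume "\<not> thesis"
  then have nz: "\<psi> $ k \<noteq> 0" for k
    using that by blast
  have "det ?A = (\<Prod>i\<in>UNIV. ?A $ i $ i)"
    by (rule det_diagonal) (simp add: dephasing_nth)
  then have "det ?A \<noteq> 0"
    by (simp add: dephasing_nth nz)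
  then have "invertible ?A"
    by (simp add: invertible_det_nz)
  then have "\<exists>B. B ** ?A = mat 1"
    by (auto simp: invertible_def)
  \<comment> \<open>\<open>rank\<close> is the dimension of the row space, and a left inverse makes
    the rows span everything.\<close>
  then have "vec.span (rows ?A) = UNIV"
    by (simp add: matrix_left_invertible_span_rows_gen)
  then have "vec.dim (rows ?A) = CARD('d)"
    by (metis vec.dim_span vec_dim_card)
  then show False
    using assms by (simp add: row_rank_def_gen)
qed

theorem theorem2:
  fixes h :: nat and c :: "('d::finite \<Rightarrow> nat) \<Rightarrow> complex" and m :: real
    and \<psi> :: "complex^'d"
  assumes "h \<ge> 1" and "m > 0"
    and "crit_C1 (poly_coherence h c m)"
    and "crit_C2 (poly_coherence h c m)"
    and "crit_C3 (poly_coherence h c m)"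
    and "norm \<psi> = 1"
    and "rank (dephasing (ketbra \<psi> \<psi>)) < CARD('d)"
  shows "poly_coherence_pure h c m \<psi> = 0"
proof -
  obtain k where "\<psi> $ k = 0"
    using rank_dephasing_ketbra_less[OF assms(7)] .
  then have "hom_poly h c \<psi> = 0"
    by (rule hom_poly_eq_0_if_zero_coordinate[OF assms(1,2,4)])
  then show ?thesis
    by (simp add: poly_coherence_pure_def)
qed

end
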